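(* Let $L>0$ and $\lambda_*>0$, and let $\beta^*\in\mathbb{R}^p$ be defined by $$\beta^*:=\arg\min\Big\{\|X(\beta-\beta^0)\|_n^2+\lambda_*^2|S_\beta|/\hat\phi^2(L,S_\beta):\ \|\beta\|_1\ge\|\beta^0\|_1\Big\}.$$ Let $S_*:=\{j:\beta_j^*\ne0\}$ be the active set of $\beta^*$. Then $$\lambda_*\|\beta^*-\beta^0\|_1\le\|X(\beta^*-\beta^0)\|_n^2+\frac{\lambda_*^2|S_*|}{\hat\phi^2(1,S_* )}.$$
   Context: $X$ is a fixed $n\times p$ real matrix of rank $n$ and $\beta^0\in\mathbb{R}^p$ is a fixed vector. For $v\in\mathbb{R}^n$, $\|v\|_n:=\sqrt{v^Tv/n}$. For $\beta\in\mathbb{R}^p$, $S_\beta:=\{j:\beta_j\ne0\}$. For $S\subset\{1,\dots,p\}$, $\beta_S\in\mathbb{R}^p$ has entries $\beta_j$ for $j\in S$ and $0$ otherwise. The compatibility constant, for $L>0$, is $$\hat\phi^2(L,S):=\min\{|S|\,\|X\beta_S-X\beta_{S^c}\|_n^2:\ \|\beta_S\|_1=1,\ \|\beta_{S^c}\|_1\le L\}.$$ Conventions: $|S|/\hat\phi^2(L,S)$ is $0$ if $S=\emptyset$ and $+\infty$ if $S\ne\emptyset$ and $\hat\phi(L,S)=0$. $\beta^*$ is any minimizer (assumed to exist). *)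

theory Defs
  imports "HOL-Analysis.Analysis"
begin

definition norm_n :: "real ^ 'n::finite \<Rightarrow> real" where
  "norm_n v = sqrt ((v \<bullet> v) / real CARD('n))"

definition l1_norm :: "real ^ 'p::finite \<Rightarrow> real" where
  "l1_norm \<beta> = (\<Sum>j\<in>UNIV. \<bar>\<beta> $ j\<bar>)"

definition active_set :: "real ^ 'p::finite \<Rightarrow> 'p set" where
  "active_set \<beta> = {j. \<beta> $ j \<noteq> 0}"

definition restrict_vec :: "'p set \<Rightarrow> real ^ 'p::finite \<Rightarrow> real ^ 'p" where
  "restrict_vec S \<beta> = (\<chi> j. if j \<in> S then \<beta> $ j else 0)"

definition compat_feasible :: "real \<Rightarrow> 'p set \<Rightarrow> (real ^ 'p::finite) set" where
  "compat_feasible L S =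
    {\<beta>. l1_norm (restrict_vec S \<beta>) = 1 \<and> l1_norm (restrict_vec (- S) \<beta>) \<le> L}"

text \<open>
  The squared compatibility constant. For nonempty \<open>S\<close> and \<open>L \<ge> 0\<close> the infimum is
  a minimum (lemma \<open>compat_sq_attained\<close> below); for empty \<open>S\<close> there is no feasible
  vector and the value is never used.
\<close>

definition compat_sq :: "real ^ 'p::finite ^ 'n::finite \<Rightarrow> real \<Rightarrow> 'p set \<Rightarrow> real" where
  "compat_sq X L S =
    (INF \<beta>\<in>compat_feasible L S.
      real (card S) * (norm_n (X *v restrict_vec S \<beta> - X *v restrict_vec (- S) \<beta>))\<^sup>2)"

definition compat_ratio :: "real ^ 'p::finite ^ 'n::finite \<Rightarrow> real \<Rightarrow> 'p set \<Rightarrow> ereal" where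
  "compat_ratio X L S =
    (if S = {} then 0
     else if compat_sq X L S = 0 then \<infinity>
     else ereal (real (card S) / compat_sq X L S))"

definition oracle_objective ::
  "real ^ 'p::finite ^ 'n::finite \<Rightarrow> real ^ 'p \<Rightarrow> real \<Rightarrow> real \<Rightarrow> real ^ 'p \<Rightarrow> ereal" where
  "oracle_objective X \<beta>0 L lam \<beta> =
    ereal ((norm_n (X *v (\<beta> - \<beta>0)))\<^sup>2) + ereal (lam\<^sup>2) * compat_ratio X L (active_set \<beta>)"

lemma compact_compat_feasible: "compact (compat_feasible L S)"
proof -
  have "bounded (compat_feasible L S)"
  proof (rule boundedI)
    fix \<beta> assume b: "\<beta> \<in> compat_feasible L S"
    have "norm \<beta> \<le> (\<Sum>j\<in>UNIV. \<bar>\<beta> $ j\<bar>)" by (rule norm_le_l1_cart)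
    also have "\<dots> = l1_norm (restrict_vec S \<beta>) + l1_norm (restrict_vec (- S) \<beta>)"
      unfolding l1_norm_def restrict_vec_def sum.distrib[symmetric]
      by (rule sum.cong) auto
    also have "\<dots> \<le> 1 + L" using b by (simp add: compat_feasible_def)
    finally show "norm \<beta> \<le> 1 + L" .
  qed
  moreover have "closed (compat_feasible L S)"
  proof -
    have cont: "continuous_on UNIV (\<lambda>\<beta>. l1_norm (restrict_vec T \<beta>))" for T :: "'a set"
    proof -
      have eq: "(\<lambda>\<beta>. l1_norm (restrict_vec T \<beta>)) = (\<lambda>\<beta>. \<Sum>j\<in>T. \<bar>\<beta> $ j\<bar>)"
        unfolding l1_norm_def restrict_vec_def
        by (auto simp: fun_eq_iff if_distrib[of abs] sum.If_cases)
      show ?thesis unfolding eq by (intro continuous_intros)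
    qed
    show ?thesis
      unfolding compat_feasible_def
      by (intro closed_Collect_conj closed_Collect_eq closed_Collect_le cont continuous_on_const)
  qed
  ultimately show ?thesis by (simp add: compact_eq_bounded_closed)
qed

lemma compat_sq_attained:
  fixes X :: "real ^ 'p::finite ^ 'n::finite"
  assumes "S \<noteq> {}" and "L \<ge> 0"
  obtains \<beta> where "\<beta> \<in> compat_feasible L S"
    and "compat_sq X L S =
      real (card S) * (norm_n (X *v restrict_vec S \<beta> - X *v restrict_vec (- S) \<beta>))\<^sup>2"
    and "\<And>\<gamma>. \<gamma> \<in> compat_feasible L S \<Longrightarrow> compat_sq X L S \<le>
      real (card S) * (norm_n (X *v restrict_vec S \<gamma> - X *v restrict_vec (- S) \<gamma>))\<^sup>2"
proof -
  let ?f = "\<lambda>\<beta>. real (card S) *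
    (norm_n (X *v restrict_vec S \<beta> - X *v restrict_vec (- S) \<beta>))\<^sup>2"
  obtain k where k: "k \<in> S" using assms(1) by blast
  have "l1_norm (restrict_vec S (axis k 1)) = (\<Sum>j\<in>UNIV. if j = k then 1 else 0)"
    unfolding l1_norm_def restrict_vec_def axis_def using k by (intro sum.cong) auto
  moreover have "l1_norm (restrict_vec (- S) (axis k 1)) = 0"
    unfolding l1_norm_def restrict_vec_def axis_def using k by (intro sum.neutral) auto
  ultimately have ne: "compat_feasible L S \<noteq> {}"
    using assms(2) by (auto simp: compat_feasible_def intro!: exI[of _ "axis k 1"])
  have lin: "linear (\<lambda>\<beta>. X *v restrict_vec T \<beta>)" for T
    by (rule linearI) (simp_all add: vec_eq_iff restrict_vec_def matrix_vector_mult_def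
      sum.distrib[symmetric] sum_distrib_left if_distrib algebra_simps cong: if_cong sum.cong)
  have "continuous_on (compat_feasible L S) ?f"
    unfolding norm_n_def
    by (intro continuous_intros linear_continuous_on lin[THEN linear_conv_bounded_linear[THEN iffD1]]) auto
  then obtain \<beta> where b: "\<beta> \<in> compat_feasible L S"
      and m: "\<And>\<gamma>. \<gamma> \<in> compat_feasible L S \<Longrightarrow> ?f \<beta> \<le> ?f \<gamma>"
    using continuous_attains_inf[OF compact_compat_feasible ne] by blast
  have "compat_sq X L S = ?f \<beta>"
    unfolding compat_sq_def using b m by (intro cInf_eq_minimum) auto
  with b m show ?thesis by (intro that) auto
qed

end

theory Submission
  imports Defs
begin

text \<open>
  Write \<open>S\<close> for the active set of \<open>\<beta>star\<close> and \<open>d = \<beta>star - \<beta>0\<close>. Since \<open>\<beta>star\<close> vanishes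
  off \<open>S\<close>, the triangle inequality and the constraint \<open>l1_norm \<beta>star \<ge> l1_norm \<beta>0\<close>
  put \<open>d\<close> in the cone where the part of \<open>d\<close> off \<open>S\<close> has at most the \<open>l1\<close> norm of the part on \<open>S\<close>.
  Compatibility with constant 1 then bounds \<open>l1_norm d\<close> by twice the square root of
  \<open>card S / compat_sq X 1 S\<close> times \<open>norm_n (X *v d)\<close>, and \<open>2 a b \<le> a\<^sup>2 + b\<^sup>2\<close> concludes.
\<close>

lemma l1_norm_restrict: "l1_norm (restrict_vec S \<beta>) = (\<Sum>j\<in>S. \<bar>\<beta> $ j\<bar>)"
  unfolding l1_norm_def restrict_vec_def
  by (simp add: if_distrib[of abs] sum.If_cases)

lemma l1_norm_split: "l1_norm \<beta> = l1_norm (restrict_vec S \<beta>) + l1_norm (restrict_vec (- S) \<beta>)"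
  unfolding l1_norm_restrict unfolding l1_norm_def
  by (subst sum.union_disjoint[symmetric]) auto

lemma l1_norm_nonneg: "l1_norm \<beta> \<ge> 0"
  by (simp add: l1_norm_def sum_nonneg)

lemma restrict_vec_add_compl: "restrict_vec S \<beta> + restrict_vec (- S) \<beta> = \<beta>"
  by (simp add: restrict_vec_def vec_eq_iff)

lemma norm_n_scaleR_sq: "(norm_n (c *\<^sub>R v))\<^sup>2 = c\<^sup>2 * (norm_n v)\<^sup>2"
  by (simp add: norm_n_def power_mult_distrib power2_norm_eq_inner[symmetric])

lemma compat_sq_nonneg:
  assumes "S \<noteq> {}" "L \<ge> 0"
  shows "compat_sq X L S \<ge> 0"
  by (rule compat_sq_attained[OF assms, of X]) simp

lemma compat_sq_le:
  assumes "S \<noteq> {}" "L \<ge> 0" "\<gamma> \<in> compat_feasible L S"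
  shows "compat_sq X L S \<le>
    real (card S) * (norm_n (X *v restrict_vec S \<gamma> - X *v restrict_vec (- S) \<gamma>))\<^sup>2"
  by (rule compat_sq_attained[OF assms(1,2), of X]) (use assms(3) in blast)

lemma compat_sq_le_on_cone:
  assumes "S \<noteq> {}" "L \<ge> 0"
    and cone: "l1_norm (restrict_vec (- S) d) \<le> L * l1_norm (restrict_vec S d)"
  shows "compat_sq X L S * (l1_norm (restrict_vec S d))\<^sup>2 \<le> real (card S) * (norm_n (X *v d))\<^sup>2"
proof (cases "l1_norm (restrict_vec S d) = 0")
  case True
  then show ?thesis by simp
next
  case False
  define t where "t = l1_norm (restrict_vec S d)"
  have t: "t > 0" using False l1_norm_nonneg[of "restrict_vec S d"] by (simp add: t_def)
  \<comment> \<open>\<open>compat_sq\<close> subtracts the part off \<open>S\<close>, so its sign is flipped here.\<close>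
  define \<gamma> where "\<gamma> = (1 / t) *\<^sub>R (restrict_vec S d - restrict_vec (- S) d)"
  have \<gamma>S: "restrict_vec S \<gamma> = (1 / t) *\<^sub>R restrict_vec S d"
    and \<gamma>C: "restrict_vec (- S) \<gamma> = - ((1 / t) *\<^sub>R restrict_vec (- S) d)"
    by (auto simp: \<gamma>_def restrict_vec_def vec_eq_iff)
  have scale: "l1_norm ((1 / t) *\<^sub>R v) = l1_norm v / t" for v :: "real ^ 'a"
    using t by (simp add: l1_norm_def abs_mult sum_divide_distrib)
  have "l1_norm (restrict_vec S \<gamma>) = 1"
    unfolding \<gamma>S scale using t by (simp add: t_def)
  moreover have "l1_norm (restrict_vec (- S) \<gamma>) = l1_norm (restrict_vec (- S) d) / t"
    unfolding \<gamma>C scale[symmetric] by (simp add: l1_norm_def)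
  ultimately have "\<gamma> \<in> compat_feasible L S"
    using cone t by (simp add: compat_feasible_def t_def[symmetric] pos_divide_le_eq)
  moreover have "X *v restrict_vec S \<gamma> - X *v restrict_vec (- S) \<gamma> = (1 / t) *\<^sub>R (X *v d)"
  proof -
    have "restrict_vec S \<gamma> - restrict_vec (- S) \<gamma> = (1 / t) *\<^sub>R d"
      unfolding \<gamma>S \<gamma>C using restrict_vec_add_compl[of S d]
      by (simp add: scaleR_add_right[symmetric])
    then show ?thesis
      by (metis matrix_vector_mult_diff_distrib matrix_vector_mult_scaleR)
  qed
  ultimately have "compat_sq X L S \<le> real (card S) * ((1 / t)\<^sup>2 * (norm_n (X *v d))\<^sup>2)"
    by (metis compat_sq_le norm_n_scaleR_sq assms(1,2))
  then show ?thesis using t by (simp add: t_def[symmetric] field_simps)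
qed

lemma l1_norm_cone:
  fixes \<beta> \<beta>' :: "real ^ 'p::finite"
  assumes "l1_norm \<beta> \<ge> l1_norm \<beta>'"
  defines "S \<equiv> active_set \<beta>"
  shows "l1_norm (restrict_vec (- S) (\<beta> - \<beta>')) \<le> l1_norm (restrict_vec S (\<beta> - \<beta>'))"
proof -
  have "l1_norm (restrict_vec (- S) (\<beta> - \<beta>')) = l1_norm (restrict_vec (- S) \<beta>')"
    unfolding l1_norm_restrict by (intro sum.cong) (auto simp: S_def active_set_def)
  also have "\<dots> \<le> l1_norm (restrict_vec S \<beta>) - l1_norm (restrict_vec S \<beta>')"
  proof -
    have "l1_norm (restrict_vec (- S) \<beta>) = 0"
      unfolding l1_norm_restrict by (intro sum.neutral) (auto simp: S_def active_set_def)
    then show ?thesis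
      using assms(1) l1_norm_split[of \<beta> S] l1_norm_split[of \<beta>' S] by linarith
  qed
  also have "\<dots> \<le> l1_norm (restrict_vec S (\<beta> - \<beta>'))"
    unfolding l1_norm_restrict sum_subtractf[symmetric] by (intro sum_mono) auto
  finally show ?thesis .
qed

theorem lemma1p3p1:
  fixes X :: "real ^ 'p::finite ^ 'n::finite"
    and \<beta>0 \<beta>star :: "real ^ 'p"
    and L lam :: real
  assumes "rank X = CARD('n)"
    and "L > 0"
    and "lam > 0"
    and "is_arg_min (oracle_objective X \<beta>0 L lam) (\<lambda>\<beta>. l1_norm \<beta> \<ge> l1_norm \<beta>0) \<beta>star"
  shows "ereal (lam * l1_norm (\<beta>star - \<beta>0)) \<le>
    ereal ((norm_n (X *v (\<beta>star - \<beta>0)))\<^sup>2)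
      + ereal (lam\<^sup>2) * compat_ratio X 1 (active_set \<beta>star)"
proof -
  define S where "S = active_set \<beta>star"
  define d where "d = \<beta>star - \<beta>0"
  define t where "t = l1_norm (restrict_vec S d)"
  define N where "N = norm_n (X *v d)"
  define \<phi> where "\<phi> = compat_sq X 1 S"
  have cone: "l1_norm (restrict_vec (- S) d) \<le> t"
    unfolding t_def S_def d_def using assms(4) by (intro l1_norm_cone) (simp add: is_arg_min_def)
  then have d_le: "l1_norm d \<le> 2 * t"
    using l1_norm_split[of d S] by (simp add: t_def)
  consider "S = {}" | "S \<noteq> {}" "\<phi> = 0" | "S \<noteq> {}" "\<phi> \<noteq> 0" by blast
  then have "ereal (lam * l1_norm d) \<le> ereal (N\<^sup>2) + ereal (lam\<^sup>2) * compat_ratio X 1 S"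
  proof cases
    case 1
    then have "l1_norm d \<le> 0" using d_le by (simp add: t_def l1_norm_restrict)
    then have "lam * l1_norm d \<le> 0" using assms(3) by (simp add: mult_le_0_iff)
    also have "0 \<le> N\<^sup>2" by simp
    finally show ?thesis using 1 by (simp add: compat_ratio_def)
  next
    case 2
    then show ?thesis using assms(3) by (simp add: compat_ratio_def \<phi>_def)
  next
    case 3
    have pos: "\<phi> > 0" using 3 compat_sq_nonneg[of S 1 X] by (simp add: \<phi>_def)
    have "\<phi> * t\<^sup>2 \<le> real (card S) * N\<^sup>2"
      unfolding \<phi>_def t_def N_def using 3 cone by (intro compat_sq_le_on_cone) (simp_all add: t_def)
    then have sq: "t\<^sup>2 \<le> N\<^sup>2 * (real (card S) / \<phi>)"
      using pos by (simp add: field_simps)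
    define r where "r = sqrt (real (card S) / \<phi>)"
    have N: "N \<ge> 0" by (simp add: N_def norm_n_def)
    have r: "r \<ge> 0" "r\<^sup>2 = real (card S) / \<phi>" using pos by (simp_all add: r_def)
    have "t\<^sup>2 \<le> (N * r)\<^sup>2" using sq by (simp add: power_mult_distrib r(2))
    then have "t \<le> N * r" by (rule power2_le_imp_le) (simp add: N r(1))
    with d_le have "l1_norm d \<le> 2 * (N * r)" by linarith
    then have "lam * l1_norm d \<le> lam * (2 * (N * r))" using assms(3) by simp
    also have "\<dots> \<le> N\<^sup>2 + lam\<^sup>2 * r\<^sup>2"
      using sum_squares_bound[of N "lam * r"] by (simp add: power_mult_distrib algebra_simps)
    finally show ?thesis using 3 by (simp add: compat_ratio_def \<phi>_def[symmetric] r(2))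
  qed
  then show ?thesis by (simp add: S_def d_def N_def)
qed

end
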